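(* Let $n_1,n_2,n_3\in\mathbb C$ and let $\alpha_0,\alpha_1,\alpha_2,\alpha_3$ be constant (complex) parameters, with $t\in\mathbb C\setminus\{0\}$. Suppose that a system of the form $(S)$ (see context), with coefficients $a_1,\dots,a_{10}\in\mathbb C(t)$, has the following Painlevé scheme for some $f_0,f_1,f_2\in\mathbb C(t)$: (i) $X=0$ is an accessible singular point of multiplicity $2$, and in the coordinates $(X',Y')=(x,x^2y)$ the point $(X',Y')=(0,-t)$ is an accessible singular point with matrix of linear approximation $f_0\begin{pmatrix}1&0\\ 2\alpha_3&n_3\end{pmatrix}$; (ii) $X=1$ is an accessible singular point with matrix of linear approximation $f_1\begin{pmatrix}n_1&\alpha_0\\ 0&1\end{pmatrix}$; (iii) $X=\infty$ is an accessible singular point with matrix of linear approximation $f_2\begin{pmatrix}n_2&\alpha_1\\ 0&1\end{pmatrix}$. Then the system coincides with $$\begin{aligned}\delta\frac{dx}{dt}=&\,2n_1n_2x^3y-2n_1n_2x^2y-2n_1(\alpha_1-n_2\alpha_2)x^2\\ &+\{2n_2\alpha_0+2n_1\alpha_1-2n_1n_2\alpha_2+(n_1+n_2)t\}x-(n_1+n_2)t,\\ \delta\frac{dy}{dt}=&-2n_1(2n_2-1)x^2y^2+2(2n_1n_2-n_1-n_2)xy^2+2n_1\{2\alpha_1-(3n_2-2)\alpha_2\}xy\\ &-\{2n_2\alpha_0+2n_1\alpha_1-2(2n_1n_2-n_1-n_2)\alpha_2+(n_1+n_2)t\}y+2n_1\alpha_2(\alpha_1+\alpha_2-n_2\alpha_2),\end{aligned}$$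 where $\delta:=t\{2n_2\alpha_0+2n_1\alpha_1-2(n_1+n_2)\alpha_2+2(2n_1n_2-n_1-n_2)\alpha_3-(n_1-n_2)t\}$.
   Context: System $(S)$: for a constant $\alpha_2\in\mathbb C$ and $a_i=a_i(t)\in\mathbb C(t)$, $$\frac{dx}{dt}=a_1x^3y+a_2x^2y+a_5xy+a_7y+\tfrac12\big((3a_1+2a_3)\alpha_2-a_4\big)x^2+\big((a_2+a_9)\alpha_2-a_6\big)x+a_8,$$ $$\frac{dy}{dt}=a_3x^2y^2+a_9xy^2+a_{10}y^2+a_4xy+a_6y+\tfrac12(a_1\alpha_2+a_4)\alpha_2 .$$ It is also polynomial in the coordinates $(x_1,y_1)=(1/x,\,-(xy+\alpha_2)x)$. Points $X=1$ and $X=\infty$: use local coordinates $(X,Y)=(x-1,1/y)$, resp. $(X,Y)=(x_1,1/y_1)$. In them the system has the form $\frac{dX}{dt}=\frac{G(X,Y)}{Y}$, $\frac{dY}{dt}=H(X,Y)$ with $G,H\in\mathbb C(t)[X,Y]$. The point $(0,0)$ is an accessible singular point if $G(0,0)=0$, and its matrix of linear approximation is $M=\begin{pmatrix}M_{11}&M_{12}\\ 0&M_{22}\end{pmatrix}$ with $\frac{d}{dt}\binom XY=\frac1Y\{ M\binom XY+(\text{terms of order}\ge2)\}$, i.e. $G=M_{11}X+M_{12}Y+O(2)$, $H(0,0)=M_{22}$. Point $X=0$ of multiplicity $2$ (a double point resolved by two blow-ups): for system $(S)$ this is the condition that the coefficient of $y$ in $dx/dt$ is divisible by $x^2$ and the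 coefficient of $y^2$ in $dy/dt$ is divisible by $x$, i.e. $a_5=a_7=a_{10}=0$. Then in $(X',Y')=(x,x^2y)$, with $W=Y'+t$, the system has the form $\frac{dX'}{dt}=A(X',W)$, $\frac{dW}{dt}=\frac{B(X',W)}{X'}$ with $A,B\in\mathbb C(t)[X',W]$; $(X',W)=(0,0)$ is an accessible singular point if $B(0,0)=0$, and its matrix of linear approximation is $M=\begin{pmatrix}M_{11}&0\\ M_{21}&M_{22}\end{pmatrix}$ with $A(0,0)=M_{11}$ and $B=M_{21}X'+M_{22}W+(\text{terms of order}\ge2)$. *)

theory Defs
  imports "HOL-Computational_Algebra.Computational_Algebra"
begin

text \<open>
  A system is treated as a vector field over \<open>\<complex>(t)\<close>: the time derivative along its solutions is
  the derivation \<open>D = d/dt\<close> of the field \<open>\<complex>(t)(x,y)\<close> which vanishes on \<open>\<complex>\<close>, satisfies \<open>D t = 1\<close>,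
  and takes \<open>x\<close> and \<open>y\<close> to the right-hand sides of the system (for any prescribed
  \<open>D x\<close> and \<open>D y\<close> exactly one such \<open>D\<close> exists).  Rewriting the system in other
  coordinates \<open>(X,Y)\<close> then means computing \<open>D X\<close> and \<open>D Y\<close>.
\<close>

type_synonym ratfun = "complex poly fract"

text \<open>\<open>\<complex>(t)(x,y)\<close>, as the fraction field of \<open>\<complex>(t)[x][y]\<close>: the inner polynomial variable is \<open>x\<close>,
  the outer one is \<open>y\<close>.\<close>
type_synonym field_txy = "ratfun poly poly fract"

definition emb :: "ratfun \<Rightarrow> field_txy" where
  "emb a = to_fract [:[:a:]:]"

definition const_t :: "complex \<Rightarrow> ratfun" where
  "const_t c = to_fract [:c:]"

definition var_t :: ratfun where
  "var_t = to_fract [:0, 1:]"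

definition cst :: "complex \<Rightarrow> field_txy" where
  "cst c = emb (const_t c)"

definition tF :: field_txy where
  "tF = emb var_t"

definition xF :: field_txy where
  "xF = to_fract [:[:0, 1:]:]"

definition yF :: field_txy where
  "yF = to_fract [:0, 1:]"

definition time_derivation :: "(field_txy \<Rightarrow> field_txy) \<Rightarrow> bool" where
  "time_derivation D \<longleftrightarrow>
     (\<forall>u v. D (u + v) = D u + D v) \<and>
     (\<forall>u v. D (u * v) = u * D v + D u * v) \<and>
     (\<forall>c. D (cst c) = 0) \<and>
     D tF = 1"

text \<open>System \<open>(S)\<close>; only the values \<open>a 1, \<dots>, a 10\<close> are used.\<close>
definition system_S :: "complex \<Rightarrow> (nat \<Rightarrow> ratfun) \<Rightarrow> (field_txy \<Rightarrow> field_txy) \<Rightarrow> bool" where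
  "system_S \<alpha>\<^sub>2 a D \<longleftrightarrow>
     D xF = emb (a 1) * xF^3 * yF + emb (a 2) * xF^2 * yF + emb (a 5) * xF * yF + emb (a 7) * yF
          + emb (((3 * a 1 + 2 * a 3) * const_t \<alpha>\<^sub>2 - a 4) / 2) * xF^2
          + emb ((a 2 + a 9) * const_t \<alpha>\<^sub>2 - a 6) * xF + emb (a 8) \<and>
     D yF = emb (a 3) * xF^2 * yF^2 + emb (a 9) * xF * yF^2 + emb (a 10) * yF^2
          + emb (a 4) * xF * yF + emb (a 6) * yF
          + emb ((a 1 * const_t \<alpha>\<^sub>2 + a 4) * const_t \<alpha>\<^sub>2 / 2)"

text \<open>Polynomials in \<open>\<complex>(t)[X,Y]\<close> have inner variable \<open>X\<close> and outer variable \<open>Y\<close>.\<close>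

definition eval2 :: "ratfun poly poly \<Rightarrow> field_txy \<Rightarrow> field_txy \<Rightarrow> field_txy" where
  "eval2 G X Y = poly (map_poly (\<lambda>g. poly (map_poly emb g) X) G) Y"

definition coeff2 :: "ratfun poly poly \<Rightarrow> nat \<Rightarrow> nat \<Rightarrow> ratfun" where
  "coeff2 G i j = coeff (coeff G j) i"  \<comment> \<open>coefficient of \<open>X^i * Y^j\<close>\<close>

text \<open>
  In the coordinates \<open>(X,Y)\<close> the system reads \<open>dX/dt = G(X,Y)/Y\<close>, \<open>dY/dt = H(X,Y)\<close>, the origin is an
  accessible singular point, and its matrix of linear approximation has the rows \<open>(m11, m12)\<close> and
  \<open>(m21, m22)\<close>.  The polynomials \<open>G\<close> and \<open>H\<close> are unique whenever \<open>X\<close> and \<open>Y\<close> are algebraically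
  independent over \<open>\<complex>(t)\<close>.
\<close>
definition accessible_simple ::
  "(field_txy \<Rightarrow> field_txy) \<Rightarrow> field_txy \<Rightarrow> field_txy \<Rightarrow>
     ratfun \<Rightarrow> ratfun \<Rightarrow> ratfun \<Rightarrow> ratfun \<Rightarrow> bool" where
  "accessible_simple D X Y m11 m12 m21 m22 \<longleftrightarrow>
     (\<exists>G H. D X = eval2 G X Y / Y \<and> D Y = eval2 H X Y \<and>
        coeff2 G 0 0 = 0 \<and>
        m11 = coeff2 G 1 0 \<and> m12 = coeff2 G 0 1 \<and>
        m21 = 0 \<and> m22 = coeff2 H 0 0)"

text \<open>The analogue for \<open>dX/dt = A(X,W)\<close>, \<open>dW/dt = B(X,W)/X\<close>.\<close>
definition accessible_double ::
  "(field_txy \<Rightarrow> field_txy) \<Rightarrow> field_txy \<Rightarrow> field_txy \<Rightarrow>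
     ratfun \<Rightarrow> ratfun \<Rightarrow> ratfun \<Rightarrow> ratfun \<Rightarrow> bool" where
  "accessible_double D X W m11 m12 m21 m22 \<longleftrightarrow>
     (\<exists>A B. D X = eval2 A X W \<and> D W = eval2 B X W / X \<and>
        coeff2 B 0 0 = 0 \<and>
        m11 = coeff2 A 0 0 \<and> m12 = 0 \<and>
        m21 = coeff2 B 1 0 \<and> m22 = coeff2 B 0 1)"

text \<open>For system \<open>(S)\<close>, \<open>X = 0\<close> has multiplicity 2 iff \<open>x^2\<close> divides the coefficient of \<open>y\<close> in
  \<open>dx/dt\<close> and \<open>x\<close> divides the coefficient of \<open>y^2\<close> in \<open>dy/dt\<close>.\<close>
definition double_at_zero :: "(nat \<Rightarrow> ratfun) \<Rightarrow> bool" where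
  "double_at_zero a \<longleftrightarrow> a 5 = 0 \<and> a 7 = 0 \<and> a 10 = 0"

definition x1F :: field_txy where
  "x1F = 1 / xF"

definition y1F :: "complex \<Rightarrow> field_txy" where
  "y1F \<alpha>\<^sub>2 = - (xF * yF + cst \<alpha>\<^sub>2) * xF"

text \<open>The Painleve scheme; \<open>W = Y' + t\<close> is centred at \<open>(X',Y') = (0,-t)\<close>.\<close>
definition painleve_scheme ::
  "complex \<Rightarrow> complex \<Rightarrow> complex \<Rightarrow> complex \<Rightarrow> complex \<Rightarrow> complex \<Rightarrow> complex \<Rightarrow>
     ratfun \<Rightarrow> ratfun \<Rightarrow> ratfun \<Rightarrow> (nat \<Rightarrow> ratfun) \<Rightarrow> (field_txy \<Rightarrow> field_txy) \<Rightarrow> bool" where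
  "painleve_scheme n\<^sub>1 n\<^sub>2 n\<^sub>3 \<alpha>\<^sub>0 \<alpha>\<^sub>1 \<alpha>\<^sub>2 \<alpha>\<^sub>3 f\<^sub>0 f\<^sub>1 f\<^sub>2 a D \<longleftrightarrow>
     double_at_zero a \<and>
     accessible_double D xF (xF^2 * yF + tF)
       (f\<^sub>0 * 1)                  (f\<^sub>0 * 0)
       (f\<^sub>0 * const_t (2 * \<alpha>\<^sub>3)) (f\<^sub>0 * const_t n\<^sub>3) \<and>
     accessible_simple D (xF - 1) (1 / yF)
       (f\<^sub>1 * const_t n\<^sub>1) (f\<^sub>1 * const_t \<alpha>\<^sub>0)
       (f\<^sub>1 * 0)           (f\<^sub>1 * 1) \<and>
     accessible_simple D x1F (1 / y1F \<alpha>\<^sub>2)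
       (f\<^sub>2 * const_t n\<^sub>2) (f\<^sub>2 * const_t \<alpha>\<^sub>1)
       (f\<^sub>2 * 0)           (f\<^sub>2 * 1)"

end

theory Submission
  imports Defs
begin

text \<open>
  The matrices of linear approximation give a system of algebraic equations over \<open>\<complex>(t)\<close> for the
  coefficients \<open>a i\<close> and the factors \<open>f\<^sub>0, f\<^sub>1, f\<^sub>2\<close>, and that system happens to be solvable by
  successive substitution.

  In each chart the system is rewritten with explicit polynomials
  (\<open>chart_double\<close>, \<open>chart_one\<close>, \<open>chart_infinity\<close>).  The hypotheses only assert that some
  polynomials exist; they must be the explicit ones, because two chart coordinates are algebraically
  independent over \<open>\<complex>(t)\<close> (\<open>eval2_inject\<close>).  Independence is visible from the tower
  \<open>\<complex>(t) \<subset> \<complex>(t)(x) \<subset> \<complex>(t)(x,y)\<close>: in every chart the first coordinate is a fractional linear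
  function of \<open>x\<close> over \<open>\<complex>(t)\<close>, and the second is one of \<open>y\<close> over \<open>\<complex>(t)(x)\<close>.  Comparing
  coefficients therefore yields honest equations.

  Among them are \<open>f\<^sub>1 * n\<^sub>1 = a 1 = f\<^sub>2 * n\<^sub>2\<close>.  Unless \<open>n\<^sub>1 = n\<^sub>2 = 0\<close>, this says that
  \<open>f\<^sub>1 = 2 * n\<^sub>2 * g\<close> and \<open>f\<^sub>2 = 2 * n\<^sub>1 * g\<close> for one rational function \<open>g\<close>.  The equations then
  express all the \<open>a i\<close> as multiples of \<open>g\<close>, and the one inhomogeneous equation, whose constant
  term \<open>1\<close> is the derivative of \<open>t\<close> in \<open>W = x^2 * y + t\<close>, becomes \<open>\<delta> * g = 1\<close>
  (\<open>scheme_solution\<close>).  If \<open>n\<^sub>1 = n\<^sub>2 = 0\<close>, then \<open>\<delta>\<close> and all coefficients on the right-hand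
  sides vanish.
\<close>

section \<open>Transcendental elements\<close>

locale coefficient_field =
  fixes K :: "'a :: field set"
  assumes zero_closed: "0 \<in> K" and one_closed: "1 \<in> K"
    and add_closed: "u \<in> K \<Longrightarrow> v \<in> K \<Longrightarrow> u + v \<in> K"
    and mult_closed: "u \<in> K \<Longrightarrow> v \<in> K \<Longrightarrow> u * v \<in> K"
    and uminus_closed: "u \<in> K \<Longrightarrow> - u \<in> K"
    and inverse_closed: "u \<in> K \<Longrightarrow> inverse u \<in> K"

definition transcendental_over :: "'a :: field set \<Rightarrow> 'a \<Rightarrow> bool" where
  "transcendental_over K z \<longleftrightarrow> (\<forall>p. (\<forall>i. coeff p i \<in> K) \<longrightarrow> poly p z = 0 \<longrightarrow> p = 0)"

lemma transcendental_overD: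
  "transcendental_over K z \<Longrightarrow> (\<And>i. coeff p i \<in> K) \<Longrightarrow> poly p z = 0 \<Longrightarrow> p = 0"
  unfolding transcendental_over_def by blast

text \<open>Composing a polynomial relation for \<open>u * z + v\<close> with the linear polynomial \<open>u * Z + v\<close> gives
  one for \<open>z\<close>; as the linear polynomial is not constant, a nonzero relation stays nonzero.\<close>
lemma (in coefficient_field) transcendental_over_affine:
  assumes z: "transcendental_over K z" and "u \<in> K" "v \<in> K" "u \<noteq> 0"
  shows "transcendental_over K (u * z + v)"
  unfolding transcendental_over_def
proof (intro allI impI)
  fix p assume p: "\<forall>i. coeff p i \<in> K" and root: "poly p (u * z + v) = 0"
  have "pcompose p [:v, u:] = 0"
  proof (rule transcendental_overD[OF z])
    show "coeff (pcompose p [:v, u:]) i \<in> K" for i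
      using assms p
      by (intro coeff_pcompose_semiring_closed)
        (auto simp: coeff_pCons zero_closed add_closed mult_closed split: nat.splits)
    show "poly (pcompose p [:v, u:]) z = 0"
      using root by (simp add: poly_pcompose algebra_simps)
  qed
  then show "p = 0"
    using \<open>u \<noteq> 0\<close> by (simp add: pcompose_eq_0_iff)
qed

lemma (in coefficient_field) transcendental_over_neq_0:
  assumes z: "transcendental_over K z"
  shows "z \<noteq> 0"
proof
  assume "z = 0"
  have "coeff [:0, 1:] i \<in> K" for i
    by (auto simp: coeff_pCons zero_closed one_closed split: nat.splits)
  then have "[:0, 1:] = (0 :: 'a poly)"
    using \<open>z = 0\<close> by (intro transcendental_overD[OF z]) simp_all
  then show False by simp
qed

text \<open>Reversing the coefficients of a relation for \<open>1 / z\<close> gives a relation for \<open>z\<close>.\<close>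
lemma (in coefficient_field) transcendental_over_inverse:
  assumes z: "transcendental_over K z"
  shows "transcendental_over K (1 / z)"
  unfolding transcendental_over_def
proof (intro allI impI)
  have "z \<noteq> 0"
    using z by (rule transcendental_over_neq_0)
  fix p assume p: "\<forall>i. coeff p i \<in> K" and root: "poly p (1 / z) = 0"
  have "reflect_poly p = 0"
  proof (rule transcendental_overD[OF z])
    show "coeff (reflect_poly p) i \<in> K" for i
      using p by (simp add: coeff_reflect_poly zero_closed)
    show "poly (reflect_poly p) z = 0"
      using root \<open>z \<noteq> 0\<close> by (simp add: poly_reflect_poly_nz inverse_eq_divide)
  qed
  then show "p = 0" by simp
qed

section \<open>The fields of coefficients\<close>

lemma emb_0 [simp]: "emb 0 = 0" and emb_1 [simp]: "emb 1 = 1"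
  and emb_add: "emb (a + b) = emb a + emb b"
  and emb_diff: "emb (a - b) = emb a - emb b"
  and emb_uminus: "emb (- a) = - emb a"
  and emb_mult: "emb (a * b) = emb a * emb b"
  and emb_eq_iff [simp]: "emb a = emb b \<longleftrightarrow> a = b"
  by (simp_all add: emb_def one_pCons flip: to_fract_add to_fract_diff to_fract_mult to_fract_uminus
      to_fract_1)

lemma emb_eq_0_iff [simp]: "emb a = 0 \<longleftrightarrow> a = 0"
  using emb_eq_iff[of a 0] by (simp del: emb_eq_iff)

lemma emb_inverse: "emb (inverse a) = inverse (emb a)"
proof (cases "a = 0")
  case False
  then have "emb a * emb (inverse a) = 1"
    by (simp flip: emb_mult)
  then show ?thesis by (metis inverse_unique)
qed simp

lemma emb_numeral: "emb (numeral k) = numeral k"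
  by (induction k) (simp_all only: numeral.simps emb_add emb_1)

lemmas emb_hom = emb_add emb_diff emb_uminus emb_mult emb_numeral

lemma const_t_0: "const_t 0 = 0" and const_t_1: "const_t 1 = 1"
  and const_t_add: "const_t (a + b) = const_t a + const_t b"
  and const_t_diff: "const_t (a - b) = const_t a - const_t b"
  and const_t_uminus: "const_t (- a) = - const_t a"
  and const_t_mult: "const_t (a * b) = const_t a * const_t b"
  and const_t_eq_iff: "const_t a = const_t b \<longleftrightarrow> a = b"
  by (simp_all add: const_t_def one_pCons flip: to_fract_add to_fract_diff to_fract_mult
      to_fract_uminus to_fract_1)

lemma const_t_eq_0_iff: "const_t a = 0 \<longleftrightarrow> a = 0"
  using const_t_eq_iff[of a 0] by (simp add: const_t_0)

lemma const_t_numeral: "const_t (numeral k) = numeral k"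
  by (induction k) (simp_all only: numeral.simps const_t_add const_t_1)

lemmas const_t_hom = const_t_0 const_t_1 const_t_add const_t_diff const_t_uminus const_t_mult
  const_t_numeral

lemma two_ratfun_neq_0: "(2 :: ratfun) \<noteq> 0"
  using const_t_eq_0_iff[of 2] by (simp add: const_t_numeral)

lemma two_times_half_ratfun: "2 * (u / 2) = (u :: ratfun)"
  by (rule nonzero_mult_div_cancel_left[OF two_ratfun_neq_0, folded times_divide_eq_right])

lemma var_t_neq_0: "var_t \<noteq> 0"
  by (simp add: var_t_def)

interpretation constants: coefficient_field "range emb"
proof
  show "0 \<in> range emb" "1 \<in> range emb"
    by (metis emb_0 rangeI, metis emb_1 rangeI)
qed (auto simp flip: emb_add emb_mult emb_uminus emb_inverse)

text \<open>The subfield \<open>\<complex>(t)(x)\<close> of \<open>\<complex>(t)(x,y)\<close>.\<close>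
definition x_field :: "field_txy set" where
  "x_field = {to_fract [:c:] / to_fract [:d:] |c d. d \<noteq> 0}"

lemma x_fieldI: "d \<noteq> 0 \<Longrightarrow> u = to_fract [:c:] / to_fract [:d:] \<Longrightarrow> u \<in> x_field"
  unfolding x_field_def by blast

lemma to_fract_in_x_field: "to_fract [:c:] \<in> x_field"
  by (rule x_fieldI[of 1 _ c]) (simp_all add: one_pCons[symmetric])

interpretation x_field: coefficient_field x_field
proof
  show "0 \<in> x_field" "1 \<in> x_field"
    using to_fract_in_x_field[of 0] to_fract_in_x_field[of 1] by (simp_all add: one_pCons[symmetric])
next
  fix u v assume "u \<in> x_field" "v \<in> x_field"
  then obtain c d c' d' where u: "u = to_fract [:c:] / to_fract [:d:]" "d \<noteq> 0"
    and v: "v = to_fract [:c':] / to_fract [:d':]" "d' \<noteq> 0"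
    unfolding x_field_def by blast
  have "u + v = (to_fract [:c:] * to_fract [:d':] + to_fract [:c':] * to_fract [:d:])
      / (to_fract [:d:] * to_fract [:d':])"
    using u v by (simp add: add_frac_eq)
  also have "\<dots> = to_fract [:c * d' + c' * d:] / to_fract [:d * d':]"
    by (simp add: mult.commute flip: to_fract_add to_fract_mult)
  finally show "u + v \<in> x_field"
    using u v by (intro x_fieldI) auto
  have "u * v = to_fract [:c * c':] / to_fract [:d * d':]"
    unfolding u v by (simp add: mult.commute flip: to_fract_mult)
  then show "u * v \<in> x_field"
    using u v by (intro x_fieldI) auto
next
  fix u assume "u \<in> x_field"
  then obtain c d where u: "u = to_fract [:c:] / to_fract [:d:]" "d \<noteq> 0"
    unfolding x_field_def by blast
  have "to_fract [:- c:] = - to_fract [:c:]"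
    by (simp flip: to_fract_uminus)
  then have "- u = to_fract [:- c:] / to_fract [:d:]"
    unfolding u by simp
  then show "- u \<in> x_field"
    using u by (intro x_fieldI) auto
  show "inverse u \<in> x_field"
  proof (cases "c = 0")
    case True
    then show ?thesis using u \<open>u \<in> x_field\<close> by simp
  next
    case False
    then show ?thesis using u by (intro x_fieldI[of c _ d]) simp_all
  qed
qed

lemma emb_in_x_field: "emb a \<in> x_field"
  unfolding emb_def by (rule to_fract_in_x_field)

lemma xF_in_x_field: "xF \<in> x_field"
  unfolding xF_def by (rule to_fract_in_x_field)

lemma xF_neq_0: "xF \<noteq> 0" and yF_neq_0: "yF \<noteq> 0"
  by (simp_all add: xF_def yF_def)

lemma poly_emb_xF: "poly (map_poly emb q) xF = to_fract [:q:]"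
  by (induction q)
    (simp_all add: map_poly_pCons emb_def xF_def flip: to_fract_add to_fract_mult)

lemma xF_transcendental: "transcendental_over (range emb) xF"
  unfolding transcendental_over_def
proof (intro allI impI)
  fix p assume p: "\<forall>i. coeff p i \<in> range emb" and root: "poly p xF = 0"
  have "inv emb 0 = 0"
    by (rule inv_f_eq) (simp_all add: inj_on_def)
  then have "p = map_poly emb (map_poly (inv emb) p)"
    using p by (intro poly_eqI) (simp add: coeff_map_poly f_inv_into_f)
  then show "p = 0"
    using root poly_emb_xF[of "map_poly (inv emb) p"] by simp
qed

text \<open>After multiplication by a common denominator, a relation for \<open>y\<close> with coefficients in
  \<open>\<complex>(t)(x)\<close> has coefficients in \<open>\<complex>(t)[x]\<close>; such a relation is itself an element of
  \<open>\<complex>(t)[x][y]\<close>, which embeds into its field of fractions.\<close>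
lemma yF_transcendental: "transcendental_over x_field yF"
  unfolding transcendental_over_def
proof (intro allI impI)
  fix p assume p: "\<forall>i. coeff p i \<in> x_field" and root: "poly p yF = 0"
  have "\<exists>d q. d \<noteq> 0 \<and> smult (to_fract [:d:]) p = map_poly (\<lambda>c. to_fract [:c:]) q"
    using p
  proof (induction p)
    case 0
    show ?case by (intro exI[of _ 1] exI[of _ 0]) simp
  next
    case (pCons b p)
    have "b \<in> x_field"
      using pCons.prems by (metis coeff_pCons_0)
    then obtain c e where b: "b = to_fract [:c:] / to_fract [:e:]" "e \<noteq> 0"
      unfolding x_field_def by blast
    have "\<forall>i. coeff p i \<in> x_field"
      using pCons.prems by (metis coeff_pCons_Suc)
    then obtain d q where d: "d \<noteq> 0"
      and q: "smult (to_fract [:d:]) p = map_poly (\<lambda>c. to_fract [:c:]) q"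
      using pCons.IH by blast
    have "smult (to_fract [:e * d:]) p = smult (to_fract [:e:]) (smult (to_fract [:d:]) p)"
      by (simp add: mult.commute flip: to_fract_mult)
    also have "\<dots> = map_poly (\<lambda>c. to_fract [:c:]) (smult e q)"
      unfolding q by (intro poly_eqI) (simp add: coeff_map_poly flip: to_fract_mult)
    finally have tail: "smult (to_fract [:e * d:]) p = map_poly (\<lambda>c. to_fract [:c:]) (smult e q)" .
    have "to_fract [:e * d:] * b = to_fract [:e:] * to_fract [:d:] * b"
      by (simp flip: to_fract_mult)
    also have "\<dots> = to_fract [:c:] * to_fract [:d:]"
      using b by simp
    finally have "to_fract [:e * d:] * b = to_fract [:c * d:]"
      by (simp flip: to_fract_mult)
    with tail have "smult (to_fract [:e * d:]) (pCons b p)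
        = map_poly (\<lambda>c. to_fract [:c:]) (pCons (c * d) (smult e q))"
      by (simp add: map_poly_pCons)
    then show ?case
      using b d by (intro exI[of _ "e * d"]) auto
  qed
  then obtain d q where d: "d \<noteq> 0"
    and q: "smult (to_fract [:d:]) p = map_poly (\<lambda>c. to_fract [:c:]) q"
    by blast
  have "poly (map_poly (\<lambda>c. to_fract [:c:]) q) yF = to_fract q"
    by (induction q) (simp_all add: map_poly_pCons yF_def flip: to_fract_add to_fract_mult)
  then have "q = 0"
    using root by (simp flip: q)
  with q d show "p = 0" by simp
qed

section \<open>Uniqueness of the right-hand sides\<close>

lemma eval2_0 [simp]: "eval2 0 X Y = 0"
  by (simp add: eval2_def)

lemma eval2_pCons [simp]: "eval2 (pCons g G) X Y = poly (map_poly emb g) X + Y * eval2 G X Y"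
  by (simp add: eval2_def map_poly_pCons)

lemma map_poly_emb_pCons [simp]: "map_poly emb (pCons a g) = pCons (emb a) (map_poly emb g)"
  by (simp add: map_poly_pCons)

lemma map_poly_emb_diff: "map_poly emb (g - h) = map_poly emb g - map_poly emb h"
  by (intro poly_eqI) (simp add: coeff_map_poly emb_diff)

text \<open>This is the algebraic independence of \<open>X\<close> and \<open>Y\<close> over \<open>\<complex>(t)\<close>: as a polynomial in \<open>Y\<close>
  with coefficients in \<open>\<complex>(t)(x)\<close>, a relation has zero coefficients, and each of these is a
  relation for \<open>X\<close> over \<open>\<complex>(t)\<close>.\<close>
lemma eval2_inject:
  assumes X: "transcendental_over (range emb) X" "X \<in> x_field"
    and Y: "transcendental_over x_field Y"
    and eq: "eval2 G X Y = eval2 H X Y"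
  shows "G = H"
proof -
  define h where "h g = poly (map_poly emb g) X" for g
  have h_eq_0: "h g = 0 \<longleftrightarrow> g = 0" for g
  proof
    assume "h g = 0"
    then have "map_poly emb g = 0"
      by (intro transcendental_overD[OF X(1)]) (simp_all add: h_def coeff_map_poly)
    then show "g = 0"
      by (simp add: map_poly_eq_0_iff)
  qed (simp add: h_def)
  have h_diff: "h (g - g') = h g - h g'" for g g'
    by (simp add: h_def map_poly_emb_diff)
  have h_in: "h g \<in> x_field" for g
    unfolding h_def
    by (induction g)
      (simp_all add: X(2) emb_in_x_field x_field.zero_closed x_field.add_closed x_field.mult_closed)
  have "map_poly h (G - H) = map_poly h G - map_poly h H"
    by (intro poly_eqI) (simp add: coeff_map_poly h_diff h_eq_0)
  then have "poly (map_poly h (G - H)) Y = 0"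
    using eq by (simp add: eval2_def h_def[abs_def])
  then have "map_poly h (G - H) = 0"
    by (intro transcendental_overD[OF Y]) (simp_all add: coeff_map_poly h_eq_0 h_in)
  then show "G = H"
    by (simp add: map_poly_eq_0_iff h_eq_0)
qed

text \<open>Since the polynomials in a chart are unique, the matrix of linear approximation can be read
  off from any known pair of them.\<close>
lemma accessible_simple_coeffs:
  assumes "transcendental_over (range emb) X" "X \<in> x_field" "transcendental_over x_field Y" "Y \<noteq> 0"
    and acc: "accessible_simple D X Y m11 m12 m21 m22"
    and "D X = eval2 G X Y / Y" "D Y = eval2 H X Y"
  shows "coeff2 G 0 0 = 0" "m11 = coeff2 G 1 0" "m12 = coeff2 G 0 1" "m22 = coeff2 H 0 0"
proof -
  obtain G' H' where "D X = eval2 G' X Y / Y" "D Y = eval2 H' X Y" and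
    vals: "coeff2 G' 0 0 = 0" "m11 = coeff2 G' 1 0" "m12 = coeff2 G' 0 1" "m22 = coeff2 H' 0 0"
    using acc unfolding accessible_simple_def by blast
  then have "eval2 G' X Y = eval2 G X Y" "eval2 H' X Y = eval2 H X Y"
    using assms by simp_all
  then have "G' = G" "H' = H"
    using eval2_inject assms by blast+
  with vals show "coeff2 G 0 0 = 0" "m11 = coeff2 G 1 0" "m12 = coeff2 G 0 1" "m22 = coeff2 H 0 0"
    by simp_all
qed

lemma accessible_double_coeffs:
  assumes "transcendental_over (range emb) X" "X \<in> x_field" "transcendental_over x_field W" "X \<noteq> 0"
    and acc: "accessible_double D X W m11 m12 m21 m22"
    and "D X = eval2 A X W" "D W = eval2 B X W / X"
  shows "coeff2 B 0 0 = 0" "m11 = coeff2 A 0 0" "m21 = coeff2 B 1 0"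
proof -
  obtain A' B' where "D X = eval2 A' X W" "D W = eval2 B' X W / X" and
    vals: "coeff2 B' 0 0 = 0" "m11 = coeff2 A' 0 0" "m21 = coeff2 B' 1 0"
    using acc unfolding accessible_double_def by blast
  then have "eval2 A' X W = eval2 A X W" "eval2 B' X W = eval2 B X W"
    using assms by simp_all
  then have "A' = A" "B' = B"
    using eval2_inject assms by blast+
  with vals show "coeff2 B 0 0 = 0" "m11 = coeff2 A 0 0" "m21 = coeff2 B 1 0"
    by simp_all
qed

section \<open>Calculus of the time derivation\<close>

lemma
  assumes "time_derivation D"
  shows D_add: "D (u + v) = D u + D v"
    and D_mult: "D (u * v) = u * D v + D u * v"
    and D_cst: "D (cst c) = 0"
    and D_t: "D tF = 1"
  using assms unfolding time_derivation_def by blast+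

lemma D_1: "time_derivation D \<Longrightarrow> D 1 = 0"
  using D_cst[of D 1] by (simp add: cst_def const_t_1)

lemma D_uminus: "time_derivation D \<Longrightarrow> D (- u) = - D u"
  using D_add[of D u "- u"] D_add[of D 0 0] by (simp add: eq_neg_iff_add_eq_0 add.commute)

lemma D_inverse:
  assumes D: "time_derivation D" and "u \<noteq> 0"
  shows "D (1 / u) = - D u / u\<^sup>2"
proof -
  have "u * D (1 / u) + D u * (1 / u) = 0"
    using D_mult[OF D, of u "1 / u"] D_1[OF D] \<open>u \<noteq> 0\<close> by simp
  then have "u * (u * D (1 / u) + D u * (1 / u)) = 0" by simp
  then have "u\<^sup>2 * D (1 / u) = - D u"
    using \<open>u \<noteq> 0\<close> by (simp add: algebra_simps power2_eq_square eq_neg_iff_add_eq_0)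
  then show ?thesis
    using \<open>u \<noteq> 0\<close> by (metis nonzero_mult_div_cancel_left power_not_zero)
qed

section \<open>The system in the three charts\<close>

text \<open>\<open>A\<close> and \<open>B\<close> arise by substituting \<open>x^2 * y = W - t\<close> in \<open>D x\<close> and in
  \<open>x * D W = 2 * x^2 * y * D x + x^3 * D y + x\<close>.\<close>
lemma chart_double:
  assumes D: "time_derivation D" and S: "system_S \<alpha>\<^sub>2 a D" and dz: "double_at_zero a"
    and acc: "accessible_double D xF (xF^2 * yF + tF) m11 m12 m21 m22"
  shows "- 2 * var_t * (a 8 - a 2 * var_t) + a 9 * var_t\<^sup>2 = 0"
    and "m11 = a 8 - a 2 * var_t"
    and "m21 = - 2 * var_t * ((a 2 + a 9) * const_t \<alpha>\<^sub>2 - a 6 - a 1 * var_t) + a 3 * var_t\<^sup>2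
           - a 6 * var_t + 1"
proof -
  define P Q R where "P = ((3 * a 1 + 2 * a 3) * const_t \<alpha>\<^sub>2 - a 4) / 2"
    and "Q = (a 2 + a 9) * const_t \<alpha>\<^sub>2 - a 6"
    and "R = (a 1 * const_t \<alpha>\<^sub>2 + a 4) * const_t \<alpha>\<^sub>2 / 2"
  define A where "A = [:[:a 8 - a 2 * var_t, Q - a 1 * var_t, P:], [:a 2, a 1:]:]"
  define B where "B = [:[:- 2 * var_t * (a 8 - a 2 * var_t) + a 9 * var_t\<^sup>2,
        - 2 * var_t * (Q - a 1 * var_t) + a 3 * var_t\<^sup>2 - a 6 * var_t + 1,
        - 2 * var_t * P - a 4 * var_t, R:],
      [:2 * (a 8 - a 2 * var_t) - 2 * var_t * a 2 - 2 * var_t * a 9,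
        2 * (Q - a 1 * var_t) - 2 * var_t * a 1 - 2 * var_t * a 3 + a 6, 2 * P + a 4:],
      [:2 * a 2 + a 9, 2 * a 1 + a 3:]:]"
  let ?W = "xF^2 * yF + tF"
  have W: "transcendental_over x_field ?W"
    using xF_neq_0 by (intro x_field.transcendental_over_affine yF_transcendental)
      (simp_all add: tF_def emb_in_x_field power2_eq_square x_field.mult_closed xF_in_x_field)
  have Dx: "D xF = emb (a 1) * xF^3 * yF + emb (a 2) * xF^2 * yF + emb P * xF^2 + emb Q * xF + emb (a 8)"
    and Dy: "D yF = emb (a 3) * xF^2 * yF^2 + emb (a 9) * xF * yF^2
      + emb (a 4) * xF * yF + emb (a 6) * yF + emb R"
    using S dz unfolding system_S_def double_at_zero_def P_def Q_def R_def by simp_all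
  have DW: "D ?W = 2 * xF * yF * D xF + xF^2 * D yF + 1"
    unfolding power2_eq_square by (simp add: D_add[OF D] D_mult[OF D] D_t[OF D] algebra_simps)
  have DX': "D xF = eval2 A xF ?W"
    unfolding Dx A_def by (simp add: emb_hom tF_def) algebra
  have "eval2 B xF ?W = xF * D ?W"
    unfolding DW Dx Dy B_def by (simp add: emb_hom tF_def power2_eq_square) algebra
  then have DW': "D ?W = eval2 B xF ?W / xF"
    using xF_neq_0 by simp
  note coeffs = accessible_double_coeffs[OF xF_transcendental xF_in_x_field W xF_neq_0 acc DX' DW']
  show "- 2 * var_t * (a 8 - a 2 * var_t) + a 9 * var_t\<^sup>2 = 0"
    "m11 = a 8 - a 2 * var_t"
    "m21 = - 2 * var_t * ((a 2 + a 9) * const_t \<alpha>\<^sub>2 - a 6 - a 1 * var_t) + a 3 * var_t\<^sup>2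
           - a 6 * var_t + 1"
    using coeffs by (simp_all add: coeff2_def A_def B_def Q_def)
qed

text \<open>\<open>G\<close> is the Taylor expansion at \<open>x = 1\<close> of \<open>D x / y\<close>, and \<open>H\<close> that of \<open>- D y / y\<^sup>2\<close>.\<close>
lemma chart_one:
  assumes D: "time_derivation D" and S: "system_S \<alpha>\<^sub>2 a D" and dz: "double_at_zero a"
    and acc: "accessible_simple D (xF - 1) (1 / yF) m11 m12 m21 m22"
  shows "a 1 + a 2 = 0"
    and "m11 = 3 * a 1 + 2 * a 2"
    and "m12 = ((3 * a 1 + 2 * a 3) * const_t \<alpha>\<^sub>2 - a 4) / 2
           + ((a 2 + a 9) * const_t \<alpha>\<^sub>2 - a 6) + a 8"
    and "m22 = - (a 3 + a 9)"
proof -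
  define P Q R where "P = ((3 * a 1 + 2 * a 3) * const_t \<alpha>\<^sub>2 - a 4) / 2"
    and "Q = (a 2 + a 9) * const_t \<alpha>\<^sub>2 - a 6"
    and "R = (a 1 * const_t \<alpha>\<^sub>2 + a 4) * const_t \<alpha>\<^sub>2 / 2"
  define G where "G = [:[:a 1 + a 2, 3 * a 1 + 2 * a 2, 3 * a 1 + a 2, a 1:],
      [:P + Q + a 8, 2 * P + Q, P:]:]"
  define H where "H = [:[:- (a 3 + a 9), - (2 * a 3 + a 9), - a 3:], [:- (a 4 + a 6), - a 4:], [:- R:]:]"
  have X: "transcendental_over (range emb) (xF - 1)"
    using constants.transcendental_over_affine[OF xF_transcendental, of 1 "-1"]
      constants.one_closed constants.uminus_closed by simp
  have X_in: "xF - 1 \<in> x_field"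
    using x_field.add_closed[OF xF_in_x_field x_field.uminus_closed[OF x_field.one_closed]] by simp
  have Y: "transcendental_over x_field (1 / yF)"
    by (intro x_field.transcendental_over_inverse yF_transcendental)
  have Dx: "D xF = emb (a 1) * xF^3 * yF + emb (a 2) * xF^2 * yF + emb P * xF^2 + emb Q * xF + emb (a 8)"
    and Dy: "D yF = emb (a 3) * xF^2 * yF^2 + emb (a 9) * xF * yF^2
      + emb (a 4) * xF * yF + emb (a 6) * yF + emb R"
    using S dz unfolding system_S_def double_at_zero_def P_def Q_def R_def by simp_all
  have D_shift: "D (xF - 1) = D xF"
    using D_add[OF D, of xF "- 1"] D_uminus[OF D, of 1] D_1[OF D] by simp
  have DX: "D (xF - 1) = eval2 G (xF - 1) (1 / yF) / (1 / yF)"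
    using yF_neq_0 unfolding D_shift Dx G_def by (simp add: emb_hom divide_simps) algebra
  have DY: "D (1 / yF) = eval2 H (xF - 1) (1 / yF)"
    using yF_neq_0 unfolding D_inverse[OF D yF_neq_0] Dy H_def
    by (simp add: emb_hom divide_simps power2_eq_square) algebra
  have "1 / yF \<noteq> 0" using yF_neq_0 by simp
  note coeffs = accessible_simple_coeffs[OF X X_in Y this acc DX DY]
  show "a 1 + a 2 = 0" "m11 = 3 * a 1 + 2 * a 2"
    "m12 = ((3 * a 1 + 2 * a 3) * const_t \<alpha>\<^sub>2 - a 4) / 2
           + ((a 2 + a 9) * const_t \<alpha>\<^sub>2 - a 6) + a 8"
    "m22 = - (a 3 + a 9)"
    using coeffs by (simp_all add: coeff2_def G_def H_def P_def Q_def)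
qed

text \<open>
  Substituting \<open>x * y = - (X * y1 + c)\<close> turns the derivative of \<open>y1\<close> into a polynomial in
  \<open>X\<close> and \<open>y1\<close> divided by \<open>X\<^sup>2\<close>.  The relations between the coefficients of system \<open>(S)\<close>,
  solved here for \<open>a4\<close>, \<open>a6\<close> and the constant term \<open>R\<close> of \<open>dy\<close> so that no division by two is
  left, are exactly what cancels the terms of order zero and one in \<open>X\<close>.
\<close>
lemma chart_infinity_identities:
  fixes x y c a1 a2 a3 a4 a6 a8 a9 P Q R dx dy :: "'a :: field"
  defines "X \<equiv> 1 / x" and "y1 \<equiv> - (x * y + c) * x"
  assumes "x \<noteq> 0" "y1 \<noteq> 0"
    and a4: "a4 = (3 * a1 + 2 * a3) * c - 2 * P" and a6: "a6 = (a2 + a9) * c - Q"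
    and R: "R = (2 * a1 + a3) * c\<^sup>2 - P * c"
    and dx: "dx = a1 * x^3 * y + a2 * x^2 * y + P * x^2 + Q * x + a8"
    and dy: "dy = a3 * x^2 * y^2 + a9 * x * y^2 + a4 * x * y + a6 * y + R"
  shows "- dx / x\<^sup>2 * (1 / y1) =
           a1 * X + a2 * X\<^sup>2 + (1 / y1) * ((a1 * c - P) + (a2 * c - Q) * X - a8 * X\<^sup>2)"
    and "((dx * y + x * dy) * x + (x * y + c) * dx) / y1\<^sup>2 =
           (2 * a1 + a3) + (2 * a2 + a9) * X
           + (1 / y1) * ((a2 * c + a6) - 2 * a8 * X + (1 / y1) * (- c * a8))"
proof -
  \<comment> \<open>With denominators cleared, both claims are polynomial identities in \<open>x\<close> and \<open>y\<close>.\<close>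
  have "- dx * x = a1 * y1 * x\<^sup>2 + a2 * y1 * x + x * ((a1 * c - P) * x\<^sup>2 + (a2 * c - Q) * x - a8)"
    unfolding dx y1_def by algebra
  then show "- dx / x\<^sup>2 * (1 / y1) =
           a1 * X + a2 * X\<^sup>2 + (1 / y1) * ((a1 * c - P) + (a2 * c - Q) * X - a8 * X\<^sup>2)"
    using assms(3,4) unfolding X_def by (simp add: divide_simps power2_eq_square) algebra
  have "((dx * y + x * dy) * x + (x * y + c) * dx) * x =
      (2 * a1 + a3) * y1\<^sup>2 * x + (2 * a2 + a9) * y1\<^sup>2 + y1 * ((a2 * c + a6) * x - 2 * a8) - c * a8 * x"
    unfolding dx dy y1_def a4 a6 R by algebra
  then show "((dx * y + x * dy) * x + (x * y + c) * dx) / y1\<^sup>2 =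
           (2 * a1 + a3) + (2 * a2 + a9) * X
           + (1 / y1) * ((a2 * c + a6) - 2 * a8 * X + (1 / y1) * (- c * a8))"
    using assms(3,4) unfolding X_def by (simp add: divide_simps power2_eq_square) (simp add: algebra_simps)
qed

lemma chart_infinity:
  assumes D: "time_derivation D" and S: "system_S \<alpha>\<^sub>2 a D" and dz: "double_at_zero a"
    and acc: "accessible_simple D x1F (1 / y1F \<alpha>\<^sub>2) m11 m12 m21 m22"
  shows "m11 = a 1"
    and "m12 = a 1 * const_t \<alpha>\<^sub>2 - ((3 * a 1 + 2 * a 3) * const_t \<alpha>\<^sub>2 - a 4) / 2"
    and "m22 = 2 * a 1 + a 3"
proof -
  define c where "c = const_t \<alpha>\<^sub>2"
  define P Q R where "P = ((3 * a 1 + 2 * a 3) * c - a 4) / 2"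
    and "Q = (a 2 + a 9) * c - a 6"
    and "R = (a 1 * c + a 4) * c / 2"
  have a4: "a 4 = (3 * a 1 + 2 * a 3) * c - 2 * P"
    unfolding P_def two_times_half_ratfun by simp
  have a6: "a 6 = (a 2 + a 9) * c - Q"
    by (simp add: Q_def)
  have R2: "2 * R = (a 1 * c + a 4) * c"
    unfolding R_def two_times_half_ratfun by simp
  have "2 * R = 2 * ((2 * a 1 + a 3) * c\<^sup>2 - P * c)"
    unfolding R2 a4 by algebra
  then have R: "R = (2 * a 1 + a 3) * c\<^sup>2 - P * c"
    by (rule mult_left_cancel[OF two_ratfun_neq_0, THEN iffD1])
  define y1 where "y1 = y1F \<alpha>\<^sub>2"
  have y1_eq: "y1 = - (xF * yF + emb c) * xF"
    by (simp add: y1_def y1F_def cst_def c_def)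
  define G where "G = [:[:0, a 1, a 2:], [:a 1 * c - P, a 2 * c - Q, - a 8:]:]"
  define H where "H = [:[:2 * a 1 + a 3, 2 * a 2 + a 9:], [:a 2 * c + a 6, - 2 * a 8:], [:- c * a 8:]:]"
  have X: "transcendental_over (range emb) (1 / xF)"
    by (intro constants.transcendental_over_inverse xF_transcendental)
  have X_in: "1 / xF \<in> x_field"
    using x_field.inverse_closed[OF xF_in_x_field] by (simp add: inverse_eq_divide)
  have "transcendental_over x_field (- (xF * xF) * yF + - (emb c * xF))"
    using xF_neq_0 by (intro x_field.transcendental_over_affine yF_transcendental
        x_field.uminus_closed x_field.mult_closed xF_in_x_field emb_in_x_field) simp
  also have "- (xF * xF) * yF + - (emb c * xF) = y1"
    unfolding y1_eq by algebra
  finally have y1: "transcendental_over x_field y1" .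
  then have Y: "transcendental_over x_field (1 / y1)"
    by (rule x_field.transcendental_over_inverse)
  have y1_neq_0: "y1 \<noteq> 0"
    using y1 by (rule x_field.transcendental_over_neq_0)
  have Dx: "D xF = emb (a 1) * xF^3 * yF + emb (a 2) * xF^2 * yF + emb P * xF^2 + emb Q * xF + emb (a 8)"
    and Dy: "D yF = emb (a 3) * xF^2 * yF^2 + emb (a 9) * xF * yF^2
      + emb (a 4) * xF * yF + emb (a 6) * yF + emb R"
    using S dz unfolding system_S_def double_at_zero_def P_def Q_def R_def c_def by simp_all
  have Dc: "D (emb c) = 0"
    using D_cst[OF D, of \<alpha>\<^sub>2] by (simp add: cst_def c_def)
  have Dy1: "D y1 = - ((D xF * yF + xF * D yF) * xF + (xF * yF + emb c) * D xF)"
    unfolding y1_eq by (simp only: D_add[OF D] D_mult[OF D] D_uminus[OF D] Dc) algebra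
  have y1': "- (xF * yF + emb c) * xF \<noteq> 0"
    using y1_neq_0 by (simp add: y1_eq)
  note ids = chart_infinity_identities[OF xF_neq_0 y1' _ _ _ Dx Dy, folded y1_eq]
  have hyps: "emb (a 4) = (3 * emb (a 1) + 2 * emb (a 3)) * emb c - 2 * emb P"
    "emb (a 6) = (emb (a 2) + emb (a 9)) * emb c - emb Q"
    "emb R = (2 * emb (a 1) + emb (a 3)) * (emb c)\<^sup>2 - emb P * emb c"
    by (simp_all only: a4 a6 R emb_hom power2_eq_square)
  have "D (1 / xF) * (1 / y1) = eval2 G (1 / xF) (1 / y1)"
    unfolding D_inverse[OF D xF_neq_0] ids(1)[OF hyps] G_def
    by (simp add: emb_hom power2_eq_square algebra_simps)
  then have DX: "D (1 / xF) = eval2 G (1 / xF) (1 / y1) / (1 / y1)"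
    using y1_neq_0 by (simp add: field_simps)
  have DY: "D (1 / y1) = eval2 H (1 / xF) (1 / y1)"
    unfolding D_inverse[OF D y1_neq_0] Dy1 minus_minus ids(2)[OF hyps] H_def
    by (simp add: emb_hom power2_eq_square algebra_simps)
  have "1 / y1 \<noteq> 0" using y1_neq_0 by simp
  note coeffs = accessible_simple_coeffs[OF X X_in Y this acc[folded y1_def, unfolded x1F_def] DX DY]
  show "m11 = a 1"
    "m12 = a 1 * const_t \<alpha>\<^sub>2 - ((3 * a 1 + 2 * a 3) * const_t \<alpha>\<^sub>2 - a 4) / 2"
    "m22 = 2 * a 1 + a 3"
    using coeffs by (simp_all add: coeff2_def G_def H_def P_def c_def)
qed

section \<open>Solving the conditions\<close>

text \<open>
  All equations but the last one of \<open>dbl\<close> are homogeneous of degree one in the unknowns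
  \<open>a1, \<dots>, a9, P, Q, R, f0, f1, f2\<close>, so they can fix these only up to a common factor \<open>g\<close>,
  which the last one then normalises to \<open>1 / \<delta>\<close>.  The factor \<open>2\<close> in \<open>f1 = 2 * n2 * g\<close> is
  chosen to make this normalisation come out as \<open>\<delta>\<close> and not as a multiple of it.
\<close>
lemma scheme_solution:
  fixes t n1 n2 \<alpha>0 \<alpha>1 \<alpha>2 \<alpha>3 f0 f1 f2 a1 a2 a3 a4 a6 a8 a9 P Q R \<delta> :: "'a :: field"
  assumes two: "(2 :: 'a) \<noteq> 0" and t: "t \<noteq> 0" and n: "n1 \<noteq> 0 \<or> n2 \<noteq> 0"
    and P: "2 * P = (3 * a1 + 2 * a3) * \<alpha>2 - a4" and Q: "Q = (a2 + a9) * \<alpha>2 - a6"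
    and R: "2 * R = (a1 * \<alpha>2 + a4) * \<alpha>2"
    and dbl: "- 2 * t * (a8 - a2 * t) + a9 * t\<^sup>2 = 0" "f0 = a8 - a2 * t"
      "2 * \<alpha>3 * f0 = - 2 * t * (Q - a1 * t) + a3 * t\<^sup>2 - a6 * t + 1"
    and one: "a1 + a2 = 0" "f1 * n1 = 3 * a1 + 2 * a2" "f1 * \<alpha>0 = P + Q + a8" "f1 = - (a3 + a9)"
    and inf: "f2 * n2 = a1" "f2 * \<alpha>1 = a1 * \<alpha>2 - P" "f2 = 2 * a1 + a3"
    and \<delta>: "\<delta> = t * (2*n2*\<alpha>0 + 2*n1*\<alpha>1 - 2*(n1+n2)*\<alpha>2 + 2*(2*n1*n2 - n1 - n2)*\<alpha>3 - (n1-n2)*t)"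
  shows "\<delta> \<noteq> 0"
    and "\<delta> * a1 = 2*n1*n2" and "\<delta> * a2 = - (2*n1*n2)"
    and "\<delta> * P = - (2*n1*(\<alpha>1 - n2*\<alpha>2))"
    and "\<delta> * Q = 2*n2*\<alpha>0 + 2*n1*\<alpha>1 - 2*n1*n2*\<alpha>2 + (n1+n2)*t"
    and "\<delta> * a8 = - ((n1+n2)*t)"
    and "\<delta> * a3 = - (2*n1*(2*n2-1))"
    and "\<delta> * a9 = 2*(2*n1*n2-n1-n2)"
    and "\<delta> * a4 = 2*n1*(2*\<alpha>1-(3*n2-2)*\<alpha>2)"
    and "\<delta> * a6 = - (2*n2*\<alpha>0 + 2*n1*\<alpha>1 - 2*(2*n1*n2-n1-n2)*\<alpha>2 + (n1+n2)*t)"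
    and "\<delta> * R = 2*n1*\<alpha>2*(\<alpha>1+\<alpha>2-n2*\<alpha>2)"
proof -
  have f12: "f1 * n1 = f2 * n2"
    using one(1,2) inf(1) by algebra
  obtain g where g: "f1 = 2 * n2 * g" "f2 = 2 * n1 * g"
  proof (cases "n1 = 0")
    case True
    then show ?thesis
      using n f12 two that[of "f1 / (2 * n2)"] by auto
  next
    case False
    then show ?thesis
      using f12 two that[of "f2 / (2 * n1)"] by (simp add: field_simps)
  qed
  have a1: "a1 = 2*n1*n2*g" using inf(1) g(2) by (simp add: mult_ac)
  have a2: "a2 = - (2*n1*n2)*g" using one(1) a1 by algebra
  have a3: "a3 = - (2*n1*(2*n2-1))*g" using inf(3) g a1 by algebra
  have a9: "a9 = 2*(2*n1*n2-n1-n2)*g" using one(4) g a3 by algebra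
  \<comment> \<open>The first equation of \<open>dbl\<close> reads \<open>a9 * t\<^sup>2 = 2 * t * f0\<close>.\<close>
  have "2 * t * f0 = 2 * t * ((2*n1*n2-n1-n2)*g*t)"
    using dbl(1,2) a9 by algebra
  then have f0: "f0 = (2*n1*n2-n1-n2)*g*t"
    using two t by simp
  have a8: "a8 = - ((n1+n2)*t)*g" using dbl(2) f0 a2 by algebra
  have P': "P = - (2*n1*(\<alpha>1 - n2*\<alpha>2))*g" using inf(2) g a1 by algebra
  have Q': "Q = (2*n2*\<alpha>0 + 2*n1*\<alpha>1 - 2*n1*n2*\<alpha>2 + (n1+n2)*t)*g"
    using one(3) g P' a8 by algebra
  have a4: "a4 = 2*n1*(2*\<alpha>1-(3*n2-2)*\<alpha>2)*g" using P P' a1 a3 by algebra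
  have a6: "a6 = - (2*n2*\<alpha>0 + 2*n1*\<alpha>1 - 2*(2*n1*n2-n1-n2)*\<alpha>2 + (n1+n2)*t)*g"
    using Q Q' a2 a9 by algebra
  have "2 * R = 2 * (2*n1*\<alpha>2*(\<alpha>1+\<alpha>2-n2*\<alpha>2)*g)"
    using R a1 a4 by algebra
  then have R': "R = 2*n1*\<alpha>2*(\<alpha>1+\<alpha>2-n2*\<alpha>2)*g"
    by (rule mult_left_cancel[OF two, THEN iffD1])
  have \<delta>g: "\<delta> * g = 1"
    using dbl(3) unfolding \<delta> f0 Q' a1 a3 a6 by algebra
  then show "\<delta> \<noteq> 0" by auto
  show "\<delta> * a1 = 2*n1*n2" "\<delta> * a2 = - (2*n1*n2)" "\<delta> * P = - (2*n1*(\<alpha>1 - n2*\<alpha>2))"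
    "\<delta> * Q = 2*n2*\<alpha>0 + 2*n1*\<alpha>1 - 2*n1*n2*\<alpha>2 + (n1+n2)*t" "\<delta> * a8 = - ((n1+n2)*t)"
    "\<delta> * a3 = - (2*n1*(2*n2-1))" "\<delta> * a9 = 2*(2*n1*n2-n1-n2)"
    "\<delta> * a4 = 2*n1*(2*\<alpha>1-(3*n2-2)*\<alpha>2)"
    "\<delta> * a6 = - (2*n2*\<alpha>0 + 2*n1*\<alpha>1 - 2*(2*n1*n2-n1-n2)*\<alpha>2 + (n1+n2)*t)"
    "\<delta> * R = 2*n1*\<alpha>2*(\<alpha>1+\<alpha>2-n2*\<alpha>2)"
    unfolding a1 a2 a3 a4 a6 a8 a9 P' Q' R' using \<delta>g by algebra+
qed

theorem theorem5p1:
  fixes n\<^sub>1 n\<^sub>2 n\<^sub>3 \<alpha>\<^sub>0 \<alpha>\<^sub>1 \<alpha>\<^sub>2 \<alpha>\<^sub>3 :: complex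
    and a :: "nat \<Rightarrow> ratfun"
    and f\<^sub>0 f\<^sub>1 f\<^sub>2 :: ratfun
    and D :: "field_txy \<Rightarrow> field_txy"
    and \<delta> :: field_txy
  assumes "time_derivation D"
    and "system_S \<alpha>\<^sub>2 a D"
    and "painleve_scheme n\<^sub>1 n\<^sub>2 n\<^sub>3 \<alpha>\<^sub>0 \<alpha>\<^sub>1 \<alpha>\<^sub>2 \<alpha>\<^sub>3 f\<^sub>0 f\<^sub>1 f\<^sub>2 a D"
    and "\<delta> = tF * (cst (2*n\<^sub>2*\<alpha>\<^sub>0 + 2*n\<^sub>1*\<alpha>\<^sub>1 - 2*(n\<^sub>1+n\<^sub>2)*\<alpha>\<^sub>2 + 2*(2*n\<^sub>1*n\<^sub>2 - n\<^sub>1 - n\<^sub>2)*\<alpha>\<^sub>3)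
                 - cst (n\<^sub>1 - n\<^sub>2) * tF)"
  shows "\<delta> * D xF =
           cst (2*n\<^sub>1*n\<^sub>2) * xF^3 * yF - cst (2*n\<^sub>1*n\<^sub>2) * xF^2 * yF
           - cst (2*n\<^sub>1*(\<alpha>\<^sub>1 - n\<^sub>2*\<alpha>\<^sub>2)) * xF^2
           + (cst (2*n\<^sub>2*\<alpha>\<^sub>0 + 2*n\<^sub>1*\<alpha>\<^sub>1 - 2*n\<^sub>1*n\<^sub>2*\<alpha>\<^sub>2) + cst (n\<^sub>1 + n\<^sub>2) * tF) * xF
           - cst (n\<^sub>1 + n\<^sub>2) * tF
       \<and> \<delta> * D yF =
           - cst (2*n\<^sub>1*(2*n\<^sub>2 - 1)) * xF^2 * yF^2
           + cst (2*(2*n\<^sub>1*n\<^sub>2 - n\<^sub>1 - n\<^sub>2)) * xF * yF^2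
           + cst (2*n\<^sub>1*(2*\<alpha>\<^sub>1 - (3*n\<^sub>2 - 2)*\<alpha>\<^sub>2)) * xF * yF
           - (cst (2*n\<^sub>2*\<alpha>\<^sub>0 + 2*n\<^sub>1*\<alpha>\<^sub>1 - 2*(2*n\<^sub>1*n\<^sub>2 - n\<^sub>1 - n\<^sub>2)*\<alpha>\<^sub>2) + cst (n\<^sub>1 + n\<^sub>2) * tF) * yF
           + cst (2*n\<^sub>1*\<alpha>\<^sub>2*(\<alpha>\<^sub>1 + \<alpha>\<^sub>2 - n\<^sub>2*\<alpha>\<^sub>2))
       \<and> (n\<^sub>1 \<noteq> 0 \<or> n\<^sub>2 \<noteq> 0 \<longrightarrow> \<delta> \<noteq> 0)"
proof (cases "n\<^sub>1 = 0 \<and> n\<^sub>2 = 0")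
  case True
  \<comment> \<open>There is no common factor \<open>g\<close> now, but both equations read \<open>0 = 0\<close>.\<close>
  then show ?thesis
    using assms(4) by (simp add: cst_def const_t_0)
next
  case False
  define P Q R where "P = ((3 * a 1 + 2 * a 3) * const_t \<alpha>\<^sub>2 - a 4) / 2"
    and "Q = (a 2 + a 9) * const_t \<alpha>\<^sub>2 - a 6"
    and "R = (a 1 * const_t \<alpha>\<^sub>2 + a 4) * const_t \<alpha>\<^sub>2 / 2"
  define d where "d = var_t * (2 * const_t n\<^sub>2 * const_t \<alpha>\<^sub>0 + 2 * const_t n\<^sub>1 * const_t \<alpha>\<^sub>1
      - 2 * (const_t n\<^sub>1 + const_t n\<^sub>2) * const_t \<alpha>\<^sub>2
      + 2 * (2 * const_t n\<^sub>1 * const_t n\<^sub>2 - const_t n\<^sub>1 - const_t n\<^sub>2) * const_t \<alpha>\<^sub>3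
      - (const_t n\<^sub>1 - const_t n\<^sub>2) * var_t)"
  have \<delta>: "\<delta> = emb d"
    unfolding assms(4) d_def by (simp add: cst_def tF_def const_t_hom emb_hom)
  have dz: "double_at_zero a"
    and acc0: "accessible_double D xF (xF^2 * yF + tF)
       (f\<^sub>0 * 1) (f\<^sub>0 * 0) (f\<^sub>0 * const_t (2 * \<alpha>\<^sub>3)) (f\<^sub>0 * const_t n\<^sub>3)"
    and acc1: "accessible_simple D (xF - 1) (1 / yF)
       (f\<^sub>1 * const_t n\<^sub>1) (f\<^sub>1 * const_t \<alpha>\<^sub>0) (f\<^sub>1 * 0) (f\<^sub>1 * 1)"
    and acc2: "accessible_simple D x1F (1 / y1F \<alpha>\<^sub>2)
       (f\<^sub>2 * const_t n\<^sub>2) (f\<^sub>2 * const_t \<alpha>\<^sub>1) (f\<^sub>2 * 0) (f\<^sub>2 * 1)"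
    using assms(3) unfolding painleve_scheme_def by blast+
  note dbl = chart_double[OF assms(1,2) dz acc0, folded Q_def]
  note one = chart_one[OF assms(1,2) dz acc1, folded P_def Q_def]
  note inf = chart_infinity[OF assms(1,2) dz acc2, folded P_def]
  have sol: "d \<noteq> 0"
    "d * a 1 = 2 * const_t n\<^sub>1 * const_t n\<^sub>2"
    "d * a 2 = - (2 * const_t n\<^sub>1 * const_t n\<^sub>2)"
    "d * P = - (2 * const_t n\<^sub>1 * (const_t \<alpha>\<^sub>1 - const_t n\<^sub>2 * const_t \<alpha>\<^sub>2))"
    "d * Q = 2 * const_t n\<^sub>2 * const_t \<alpha>\<^sub>0 + 2 * const_t n\<^sub>1 * const_t \<alpha>\<^sub>1
      - 2 * const_t n\<^sub>1 * const_t n\<^sub>2 * const_t \<alpha>\<^sub>2 + (const_t n\<^sub>1 + const_t n\<^sub>2) * var_t"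
    "d * a 8 = - ((const_t n\<^sub>1 + const_t n\<^sub>2) * var_t)"
    "d * a 3 = - (2 * const_t n\<^sub>1 * (2 * const_t n\<^sub>2 - 1))"
    "d * a 9 = 2 * (2 * const_t n\<^sub>1 * const_t n\<^sub>2 - const_t n\<^sub>1 - const_t n\<^sub>2)"
    "d * a 4 = 2 * const_t n\<^sub>1 * (2 * const_t \<alpha>\<^sub>1 - (3 * const_t n\<^sub>2 - 2) * const_t \<alpha>\<^sub>2)"
    "d * a 6 = - (2 * const_t n\<^sub>2 * const_t \<alpha>\<^sub>0 + 2 * const_t n\<^sub>1 * const_t \<alpha>\<^sub>1
      - 2 * (2 * const_t n\<^sub>1 * const_t n\<^sub>2 - const_t n\<^sub>1 - const_t n\<^sub>2) * const_t \<alpha>\<^sub>2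
      + (const_t n\<^sub>1 + const_t n\<^sub>2) * var_t)"
    "d * R = 2 * const_t n\<^sub>1 * const_t \<alpha>\<^sub>2
      * (const_t \<alpha>\<^sub>1 + const_t \<alpha>\<^sub>2 - const_t n\<^sub>2 * const_t \<alpha>\<^sub>2)"
    by (rule scheme_solution[where t = var_t and ?n1.0 = "const_t n\<^sub>1" and ?n2.0 = "const_t n\<^sub>2"
          and ?\<alpha>0.0 = "const_t \<alpha>\<^sub>0" and ?\<alpha>1.0 = "const_t \<alpha>\<^sub>1" and ?\<alpha>2.0 = "const_t \<alpha>\<^sub>2"
          and ?\<alpha>3.0 = "const_t \<alpha>\<^sub>3" and ?f0.0 = f\<^sub>0 and ?f1.0 = f\<^sub>1 and ?f2.0 = f\<^sub>2
          and ?a1.0 = "a 1" and ?a2.0 = "a 2" and ?a3.0 = "a 3" and ?a4.0 = "a 4" and ?a6.0 = "a 6"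
          and ?a8.0 = "a 8" and ?a9.0 = "a 9" and P = P and Q = Q and R = R and \<delta> = d];
        use False dbl one inf in \<open>simp add: two_ratfun_neq_0 var_t_neq_0 P_def R_def Q_def d_def
          const_t_hom const_t_eq_0_iff mult.commute\<close>)+
  have Dx: "D xF = emb (a 1) * xF^3 * yF + emb (a 2) * xF^2 * yF + emb P * xF^2 + emb Q * xF + emb (a 8)"
    and Dy: "D yF = emb (a 3) * xF^2 * yF^2 + emb (a 9) * xF * yF^2
      + emb (a 4) * xF * yF + emb (a 6) * yF + emb R"
    using assms(2) dz unfolding system_S_def double_at_zero_def P_def Q_def R_def by simp_all
  have \<delta>Dx: "\<delta> * D xF = emb (d * a 1) * xF^3 * yF + emb (d * a 2) * xF^2 * yF + emb (d * P) * xF^2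
      + emb (d * Q) * xF + emb (d * a 8)"
    unfolding \<delta> Dx by (simp add: emb_mult algebra_simps)
  have \<delta>Dy: "\<delta> * D yF = emb (d * a 3) * xF^2 * yF^2 + emb (d * a 9) * xF * yF^2
      + emb (d * a 4) * xF * yF + emb (d * a 6) * yF + emb (d * R)"
    unfolding \<delta> Dy by (simp add: emb_mult algebra_simps)
  show ?thesis
    unfolding \<delta>Dx \<delta>Dy sol(2-) using sol(1)
    by (simp add: \<delta> cst_def tF_def const_t_hom emb_hom) (simp add: algebra_simps)
qed

end
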